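(* Let $D_{V,W}(\Omega)$ be the space of random variables $\xi$ with $\sup_{x\ge0}V(x)W^{(-1)}(P\{|\xi|>x\})<\infty$. Then: (i) The functional $$\|\xi\|_{V,W}=\Big(\sup_{x>0}V(x)W^{(-1)}(P\{|\xi|>x\})\Big)^{1/2}$$ is a prenorm on $D_{V,W}(\Omega)$. (ii) If $\xi_n\in D_{V,W}(\Omega)$ is a sequence such that $\|\xi_n-\xi_m\|_{V,W}\to0$ as $n,m\to\infty$ and $\sup_n\|\xi_n\|_{V,W}<\infty$, then there exists $\xi\in D_{V,W}(\Omega)$ such that $\|\xi_n-\xi\|_{V,W}\to0$ as $n\to\infty$. (iii) The prenorm is subordinate to the function $J(\lambda)=(Z(\lambda))^{1/2}$, i.e. $\|\lambda\xi\|_{V,W}\le J(|\lambda|)\|\xi\|_{V,W}$ for $0<|\lambda|\le1$. (iv) If $W$ is a $C$-function and $V$ is the inverse function of a $C$-function (condition B1), then $\|\cdot\|_{V,W}$ is a quasinorm and $D_{V,W}(\Omega)$ is complete with respect to it. (v) For all $\xi\in D_{V,W}(\Omega)$ and all $x>0$, $$P\{|\xi|>x\}\le W\left(\frac{\|\xi\|_{V,W}^2}{V(x)}\right).$$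
   Context: $W=\{W(x),x\in\mathbb R\}$ and $V=\{V(x),x\in\mathbb R\}$ are even functions, continuous and monotonically increasing for $x>0$, positive for $x\ne0$, such that: (1) there is $C>0$ with $W^{(-1)}(x+y)\le C(W^{(-1)}(x)+W^{(-1)}(y))$ for all $x,y>0$, where $W^{(-1)}$ is the inverse of $W$ on $x>0$; (2) there is a continuous function $Z=\{Z(x),x>0\}$, $0<Z(x)<\infty$, such that for any constant $a>0$, $V(ax)\le Z(a)V(x)$ for all $x>0$; (3) $W(0)=0$. $V^{(-1)}$ is the inverse of $V$ for $x>0$. A prenorm $\Theta$ on a set of random variables satisfies $\Theta(\xi)\in[0,\infty)$, $\Theta(0)=0$, $\Theta(-\xi)=\Theta(\xi)$. A quasinorm is a functional $\|\cdot\|\ge0$ with $\|\xi\|=0\iff\xi=0$ a.s., $\|\xi+\eta\|\le\|\xi\|+\|\eta\|$, and $\|\lambda\xi\|\le\|\xi\|$ for $|\lambda|\le1$. A $C$-function is a continuous even convex function on $\mathbb R$, monotonically increasing for $x>0$ and vanishing at $0$; in B1 the inverse of a $C$-function is taken on $x>0$ and extended evenly. *)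

theory Defs
  imports "HOL-Probability.Probability"
begin

text \<open>
  Inverse of the restriction of a function to the nonnegative half-line. The point 0 is
  included since tail probabilities may vanish: for \<open>f\<close> strictly increasing on the positive
  half-line, positive there and with \<open>f 0 = 0\<close>, the value at 0 is 0. Only values at points of
  \<open>f ` {0..}\<close> are meaningful.
\<close>

definition pos_inv :: "(real \<Rightarrow> real) \<Rightarrow> real \<Rightarrow> real" where
  "pos_inv f = inv_into {0..} f"

definition C_function :: "(real \<Rightarrow> real) \<Rightarrow> bool" where
  "C_function f \<longleftrightarrow>
     continuous_on UNIV f \<and> (\<forall>x. f (- x) = f x) \<and> convex_on UNIV f \<and>
     strict_mono_on {0<..} f \<and> f 0 = 0"

text \<open>A C-function maps the nonnegative half-line onto itself, so its inverse is defined there.\<close>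

definition cond_B1 :: "(real \<Rightarrow> real) \<Rightarrow> (real \<Rightarrow> real) \<Rightarrow> bool" where
  "cond_B1 V W \<longleftrightarrow> C_function W \<and> (\<exists>U. C_function U \<and> (\<forall>x. V x = pos_inv U \<bar>x\<bar>))"

definition tail :: "'a measure \<Rightarrow> ('a \<Rightarrow> real) \<Rightarrow> real \<Rightarrow> real" where
  "tail M \<xi> x = measure M {\<omega> \<in> space M. \<bar>\<xi> \<omega>\<bar> > x}"

text \<open>Random variables are measurable functions, not identified when equal almost surely.\<close>

definition DVW :: "'a measure \<Rightarrow> (real \<Rightarrow> real) \<Rightarrow> (real \<Rightarrow> real) \<Rightarrow> ('a \<Rightarrow> real) set" where
  "DVW M V W = {\<xi> \<in> borel_measurable M. bdd_above ((\<lambda>x. V x * pos_inv W (tail M \<xi> x)) ` {0..})}"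

text \<open>
  The supremum is taken in the reals, so this functional is meaningful only on \<open>DVW M V W\<close>,
  where the set of values is bounded above.
\<close>

definition VW_norm :: "'a measure \<Rightarrow> (real \<Rightarrow> real) \<Rightarrow> (real \<Rightarrow> real) \<Rightarrow> ('a \<Rightarrow> real) \<Rightarrow> real" where
  "VW_norm M V W \<xi> = sqrt (SUP x\<in>{0<..}. V x * pos_inv W (tail M \<xi> x))"

definition linear_rv_space :: "'a measure \<Rightarrow> ('a \<Rightarrow> real) set \<Rightarrow> bool" where
  "linear_rv_space M S \<longleftrightarrow>
     S \<subseteq> borel_measurable M \<and> (\<lambda>\<omega>. 0) \<in> S \<and>
     (\<forall>\<xi>\<in>S. \<forall>\<eta>\<in>S. (\<lambda>\<omega>. \<xi> \<omega> + \<eta> \<omega>) \<in> S) \<and>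
     (\<forall>\<xi>\<in>S. \<forall>c. (\<lambda>\<omega>. c * \<xi> \<omega>) \<in> S)"

definition prenorm_on :: "('a \<Rightarrow> real) set \<Rightarrow> (('a \<Rightarrow> real) \<Rightarrow> real) \<Rightarrow> bool" where
  "prenorm_on S \<Theta> \<longleftrightarrow>
     (\<forall>\<xi>\<in>S. 0 \<le> \<Theta> \<xi>) \<and> \<Theta> (\<lambda>\<omega>. 0) = 0 \<and> (\<forall>\<xi>\<in>S. \<Theta> (\<lambda>\<omega>. - \<xi> \<omega>) = \<Theta> \<xi>)"

definition quasinorm_on ::
  "'a measure \<Rightarrow> ('a \<Rightarrow> real) set \<Rightarrow> (('a \<Rightarrow> real) \<Rightarrow> real) \<Rightarrow> bool" where
  "quasinorm_on M S N \<longleftrightarrow>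
     (\<forall>\<xi>\<in>S. 0 \<le> N \<xi>) \<and>
     (\<forall>\<xi>\<in>S. N \<xi> = 0 \<longleftrightarrow> (AE \<omega> in M. \<xi> \<omega> = 0)) \<and>
     (\<forall>\<xi>\<in>S. \<forall>\<eta>\<in>S. N (\<lambda>\<omega>. \<xi> \<omega> + \<eta> \<omega>) \<le> N \<xi> + N \<eta>) \<and>
     (\<forall>\<xi>\<in>S. \<forall>c. \<bar>c\<bar> \<le> 1 \<longrightarrow> N (\<lambda>\<omega>. c * \<xi> \<omega>) \<le> N \<xi>)"

definition Cauchy_wrt :: "(('a \<Rightarrow> real) \<Rightarrow> real) \<Rightarrow> (nat \<Rightarrow> 'a \<Rightarrow> real) \<Rightarrow> bool" where
  "Cauchy_wrt N X \<longleftrightarrow>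
     ((\<lambda>(n, m). N (\<lambda>\<omega>. X n \<omega> - X m \<omega>)) \<longlongrightarrow> 0) (sequentially \<times>\<^sub>F sequentially)"

definition converges_wrt ::
  "(('a \<Rightarrow> real) \<Rightarrow> real) \<Rightarrow> (nat \<Rightarrow> 'a \<Rightarrow> real) \<Rightarrow> ('a \<Rightarrow> real) \<Rightarrow> bool" where
  "converges_wrt N X \<xi> \<longleftrightarrow> (\<lambda>n. N (\<lambda>\<omega>. X n \<omega> - \<xi> \<omega>)) \<longlonglongrightarrow> 0"

definition complete_wrt :: "('a \<Rightarrow> real) set \<Rightarrow> (('a \<Rightarrow> real) \<Rightarrow> real) \<Rightarrow> bool" where
  "complete_wrt S N \<longleftrightarrow>
     (\<forall>X. (\<forall>n. X n \<in> S) \<and> Cauchy_wrt N X \<longrightarrow> (\<exists>\<xi>\<in>S. converges_wrt N X \<xi>))"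

end

theory Submission
  imports Defs
begin

text \<open>
  Everything rests on one reformulation. Since \<^term>\<open>W\<close> is an increasing bijection of the
  nonnegative half-line, the supremum that defines \<^term>\<open>VW_norm M V W \<xi>\<close> is at most \<open>c\<^sup>2\<close> exactly
  when \<open>P(\<bar>\<xi>\<bar> > x) \<le> W (c\<^sup>2 / V x)\<close> for every \<open>x > 0\<close>. So the functional is the best constant in a
  tail estimate (lemma \<open>VW_norm_le_iff\<close>), the Chebyshev-type estimate says that it is attained, and all
  other claims become statements about tails.

  Linearity and scaling: the tail of a sum is at most the sum of the tails at \<open>x/2\<close>. The growth bound
  \<open>V (a x) \<le> Z a * V x\<close> removes the factor \<open>1/2\<close>, and quasi-additivity of the inverse of \<^term>\<open>W\<close>
  turns a sum of two values of \<^term>\<open>W\<close> into one value of \<^term>\<open>W\<close>.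

  Completeness: a Cauchy sequence is Cauchy in probability, so by Borel-Cantelli a subsequence
  converges almost surely to some \<open>\<xi>\<close>. A bound on \<open>P(\<bar>X n - X m\<bar> > x)\<close> that holds for all large
  \<open>m\<close> passes to \<open>P(\<bar>X n - \<xi>\<bar> > x)\<close>, because strict tails are lower semicontinuous under almost sure
  convergence. As the bounds are tail estimates with the same constant for all \<open>m\<close>, this
  is convergence of \<open>X n\<close> to \<open>\<xi>\<close> in the functional itself.

  Triangle inequality under \<^term>\<open>cond_B1 V W\<close>: \<^term>\<open>W\<close> is convex and vanishes at 0, hence superadditive,
  and \<^term>\<open>V\<close> is concave, hence \<open>t * V x \<le> V (t * x)\<close> for \<open>0 \<le> t \<le> 1\<close>. Splitting the level \<open>x\<close> in
  the proportion \<open>a : b\<close> of the two norms gives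
  \<open>W (a (a + b) / V x) + W (b (a + b) / V x) \<le> W ((a + b)\<^sup>2 / V x)\<close>;
  here the square root in the definition of the norm is essential.
\<close>

section \<open>Tails of random variables\<close>

lemma (in prob_space) tail_mono:
  assumes [measurable]: "\<eta> \<in> borel_measurable M"
    and "AE \<omega> in M. \<bar>\<xi> \<omega>\<bar> > x \<longrightarrow> \<bar>\<eta> \<omega>\<bar> > y"
  shows "tail M \<xi> x \<le> tail M \<eta> y"
  unfolding tail_def using assms(2) by (intro finite_measure_mono_AE) auto

lemma (in prob_space) tail_add_le:
  assumes [measurable]: "\<xi> \<in> borel_measurable M" "\<eta> \<in> borel_measurable M"
  shows "tail M (\<lambda>\<omega>. \<xi> \<omega> + \<eta> \<omega>) (x + y) \<le> tail M \<xi> x + tail M \<eta> y"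
proof -
  have "tail M (\<lambda>\<omega>. \<xi> \<omega> + \<eta> \<omega>) (x + y)
      \<le> measure M ({\<omega> \<in> space M. \<bar>\<xi> \<omega>\<bar> > x} \<union> {\<omega> \<in> space M. \<bar>\<eta> \<omega>\<bar> > y})"
    unfolding tail_def by (intro finite_measure_mono) auto
  also have "\<dots> \<le> tail M \<xi> x + tail M \<eta> y"
    unfolding tail_def by (intro measure_Un_le) auto
  finally show ?thesis .
qed

lemma tail_cmult:
  assumes "c \<noteq> 0"
  shows "tail M (\<lambda>\<omega>. c * \<xi> \<omega>) x = tail M \<xi> (x / \<bar>c\<bar>)"
  using assms by (simp add: tail_def abs_mult pos_divide_less_eq mult.commute)

lemma tail_uminus: "tail M (\<lambda>\<omega>. - \<xi> \<omega>) x = tail M \<xi> x"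
  by (simp add: tail_def)

lemma (in prob_space) AE_eq_0_if_tail_eq_0:
  assumes [measurable]: "\<xi> \<in> borel_measurable M"
    and zero: "\<And>x. 0 < x \<Longrightarrow> tail M \<xi> x = 0"
  shows "AE \<omega> in M. \<xi> \<omega> = 0"
proof -
  have "AE \<omega> in M. \<forall>n::nat. \<not> \<bar>\<xi> \<omega>\<bar> > 1 / real (Suc n)"
    unfolding AE_all_countable
  proof
    fix n :: nat
    have "prob {\<omega> \<in> space M. \<bar>\<xi> \<omega>\<bar> > 1 / real (Suc n)} = 0"
      using zero[of "1 / real (Suc n)"] by (simp add: tail_def)
    then show "AE \<omega> in M. \<not> \<bar>\<xi> \<omega>\<bar> > 1 / real (Suc n)"
      by (subst (asm) prob_eq_0) auto
  qed
  then show ?thesis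
  proof eventually_elim
    case (elim \<omega>)
    show ?case
    proof (rule ccontr)
      assume "\<xi> \<omega> \<noteq> 0"
      then obtain n where "inverse (real (Suc n)) < \<bar>\<xi> \<omega>\<bar>"
        using reals_Archimedean[of "\<bar>\<xi> \<omega>\<bar>"] by auto
      with elim show False by (simp add: inverse_eq_divide)
    qed
  qed
qed

text \<open>
  Lower semicontinuity: a point with \<open>\<bar>\<xi> \<omega>\<bar> > x\<close> lies in \<open>{\<bar>Y k\<bar> > x}\<close> for all large \<open>k\<close>, so the
  intersections over \<open>k \<ge> j\<close>, each of measure at most \<open>b\<close>, increase to a set that contains almost
  every such point.
\<close>

lemma (in prob_space) tail_AE_limit_le:
  assumes [measurable]: "\<And>k. Y k \<in> borel_measurable M"
    and conv: "AE \<omega> in M. (\<lambda>k. Y k \<omega>) \<longlonglongrightarrow> \<xi> \<omega>"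
    and bound: "\<forall>\<^sub>F k in sequentially. tail M (Y k) x \<le> b"
  shows "tail M \<xi> x \<le> b"
proof -
  define A where "A j = {\<omega> \<in> space M. \<forall>k\<ge>j. \<bar>Y k \<omega>\<bar> > x}" for j :: nat
  have A_meas [measurable]: "A j \<in> sets M" for j
    unfolding A_def by measurable
  have "incseq A"
    by (auto simp: incseq_def A_def)
  then have lim: "(\<lambda>j. measure M (A j)) \<longlonglongrightarrow> measure M (\<Union>j. A j)"
    by (intro finite_Lim_measure_incseq) auto
  have "\<forall>\<^sub>F j in sequentially. measure M (A j) \<le> b"
    using bound
  proof eventually_elim
    case (elim j)
    have "measure M (A j) \<le> tail M (Y j) x"
      unfolding tail_def A_def by (intro finite_measure_mono) auto
    with elim show ?case by simp
  qed
  then have "measure M (\<Union>j. A j) \<le> b"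
    by (rule tendsto_upperbound[OF lim]) simp
  moreover have "tail M \<xi> x \<le> measure M (\<Union>j. A j)"
    unfolding tail_def
  proof (rule finite_measure_mono_AE)
    show "AE \<omega> in M. \<omega> \<in> {\<omega> \<in> space M. x < \<bar>\<xi> \<omega>\<bar>} \<longrightarrow> \<omega> \<in> (\<Union>j. A j)"
      using conv
    proof eventually_elim
      case (elim \<omega>)
      show ?case
      proof
        assume *: "\<omega> \<in> {\<omega> \<in> space M. x < \<bar>\<xi> \<omega>\<bar>}"
        have "(\<lambda>k. \<bar>Y k \<omega>\<bar>) \<longlonglongrightarrow> \<bar>\<xi> \<omega>\<bar>"
          using elim by (rule tendsto_rabs)
        then have "\<forall>\<^sub>F k in sequentially. x < \<bar>Y k \<omega>\<bar>"
          using * by (intro order_tendstoD) auto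
        then show "\<omega> \<in> (\<Union>j. A j)"
          using * by (auto simp: eventually_sequentially A_def)
      qed
    qed
  qed auto
  ultimately show ?thesis by simp
qed

text \<open>
  The Riesz argument: along a subsequence whose increments exceed \<open>2\<^sup>-\<^sup>k\<close> with probability at most
  \<open>2\<^sup>-\<^sup>k\<close>, almost every path has increments that are eventually dominated by a geometric series.
\<close>

lemma (in prob_space) Cauchy_in_probability_AE_convergent_subseq:
  fixes X :: "nat \<Rightarrow> 'a \<Rightarrow> real"
  assumes [measurable]: "\<And>n. X n \<in> borel_measurable M"
    and Cauchy: "\<And>e. 0 < e \<Longrightarrow> \<exists>N. \<forall>m\<ge>N. \<forall>n\<ge>N. tail M (\<lambda>\<omega>. X m \<omega> - X n \<omega>) e \<le> e"
  obtains r \<xi> where "strict_mono r" "\<xi> \<in> borel_measurable M"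
    "AE \<omega> in M. (\<lambda>k. X (r k) \<omega>) \<longlonglongrightarrow> \<xi> \<omega>"
proof -
  have "\<forall>k. \<exists>N. \<forall>m\<ge>N. \<forall>n\<ge>N. tail M (\<lambda>\<omega>. X m \<omega> - X n \<omega>) ((1/2) ^ k) \<le> (1/2) ^ k"
    using Cauchy by simp
  then obtain N where N:
    "\<And>k m n. m \<ge> N k \<Longrightarrow> n \<ge> N k \<Longrightarrow> tail M (\<lambda>\<omega>. X m \<omega> - X n \<omega>) ((1/2) ^ k) \<le> (1/2) ^ k"
    by metis
  \<comment> \<open>The summand \<open>k\<close> makes the choice strictly increasing, the sum keeps it above \<open>N k\<close>.\<close>
  define r where "r k = k + (\<Sum>i\<le>k. N i)" for k
  have r: "strict_mono r"
    by (auto simp: r_def strict_mono_Suc_iff)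
  have r_ge: "N k \<le> r k" for k
    unfolding r_def using member_le_sum[of k "{..k}" N] by simp
  define Y where "Y k = X (r k)" for k
  have [measurable]: "Y k \<in> borel_measurable M" for k
    by (simp add: Y_def)
  define A where "A k = {\<omega> \<in> space M. \<bar>Y (Suc k) \<omega> - Y k \<omega>\<bar> > (1/2) ^ k}" for k
  have A_le: "measure M (A k) \<le> (1/2) ^ k" for k
  proof -
    have "N k \<le> r (Suc k)"
      using r_ge[of k] strict_monoD[OF r, of k "Suc k"] by simp
    then show ?thesis
      using N[of k "r (Suc k)" "r k"] r_ge by (simp add: A_def Y_def tail_def)
  qed
  have "AE \<omega> in M. \<forall>\<^sub>F k in sequentially. \<omega> \<in> space M - A k"
  proof (rule borel_cantelli_AE1)
    show "A k \<in> sets M" for k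
      unfolding A_def by measurable
    show "emeasure M (A k) < \<infinity>" for k
      by (simp add: emeasure_eq_measure)
    show "summable (\<lambda>k. measure M (A k))"
      by (rule summable_comparison_test'[where g = "\<lambda>k. (1/2) ^ k" and N = 0])
        (use A_le in \<open>auto intro: summable_geometric\<close>)
  qed
  then have "AE \<omega> in M. (\<lambda>k. Y k \<omega>) \<longlonglongrightarrow> lim (\<lambda>k. Y k \<omega>)"
  proof eventually_elim
    case (elim \<omega>)
    have "\<forall>\<^sub>F k in sequentially. norm (Y (Suc k) \<omega> - Y k \<omega>) \<le> (1/2) ^ k"
      using elim by eventually_elim (auto simp: A_def)
    then have "summable (\<lambda>k. Y (Suc k) \<omega> - Y k \<omega>)"
      by (rule summable_comparison_test_ev) (simp add: summable_geometric)
    then have "convergent (\<lambda>n. Y n \<omega> - Y 0 \<omega>)"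
      using sum_lessThan_telescope[of "\<lambda>k. Y k \<omega>"] by (simp add: summable_iff_convergent)
    then have "convergent (\<lambda>n. Y n \<omega>)"
      by (simp add: convergent_diff_const_right_iff)
    then show ?case
      by (simp add: convergent_LIMSEQ_iff)
  qed
  then show ?thesis
    by (intro that[of r "\<lambda>\<omega>. lim (\<lambda>k. Y k \<omega>)"] r) (auto simp: Y_def)
qed

section \<open>The functional as the best constant in a tail estimate\<close>

text \<open>
  The point 0 is included in the assumptions on \<^term>\<open>W\<close>, so that its inverse can be applied to
  vanishing tails.
\<close>

locale tail_gauge = prob_space M for M :: "'a measure" +
  fixes V W :: "real \<Rightarrow> real"
  assumes V_pos: "0 < x \<Longrightarrow> 0 < V x"
    and W_mono: "strict_mono_on {0..} W"
    and W_onto: "W ` {0..} = {0..}"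
begin

lemma W_pos_inv:
  assumes "0 \<le> p"
  shows "W (pos_inv W p) = p" and "0 \<le> pos_inv W p"
proof -
  have "p \<in> W ` {0..}"
    using assms W_onto by simp
  then show "W (pos_inv W p) = p" "0 \<le> pos_inv W p"
    using f_inv_into_f[of p W "{0..}"] inv_into_into[of p W "{0..}"] by (auto simp: pos_inv_def)
qed

lemma W_le_iff: "0 \<le> s \<Longrightarrow> 0 \<le> t \<Longrightarrow> W s \<le> W t \<longleftrightarrow> s \<le> t"
  using strict_mono_on_less_eq[OF W_mono] by simp

lemma W_nonneg: "0 \<le> s \<Longrightarrow> 0 \<le> W s"
  using W_onto by auto

lemma pos_inv_W: "0 \<le> s \<Longrightarrow> pos_inv W (W s) = s"
  by (metis W_pos_inv W_le_iff W_nonneg order_antisym order_refl)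

lemma W_0: "W 0 = 0"
  using W_pos_inv[of 0] W_le_iff[of 0 "pos_inv W 0"] W_nonneg[of 0] by simp

lemma pos_inv_le_iff:
  assumes "0 \<le> p" "0 \<le> s"
  shows "pos_inv W p \<le> s \<longleftrightarrow> p \<le> W s"
  using W_le_iff[of "pos_inv W p" s] W_pos_inv[OF assms(1)] assms(2) by simp

definition tail_bounded :: "('a \<Rightarrow> real) \<Rightarrow> real \<Rightarrow> bool" where
  "tail_bounded \<xi> r \<longleftrightarrow> (\<forall>x>0. tail M \<xi> x \<le> W (r / V x))"

lemma tail_boundedD: "tail_bounded \<xi> r \<Longrightarrow> 0 < x \<Longrightarrow> tail M \<xi> x \<le> W (r / V x)"
  by (simp add: tail_bounded_def)

lemma tail_nonneg: "0 \<le> tail M \<xi> x"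
  by (simp add: tail_def)

lemma weighted_le_iff:
  assumes "0 < x" "0 \<le> r"
  shows "V x * pos_inv W (tail M \<xi> x) \<le> r \<longleftrightarrow> tail M \<xi> x \<le> W (r / V x)"
proof -
  have "V x * pos_inv W (tail M \<xi> x) \<le> r \<longleftrightarrow> pos_inv W (tail M \<xi> x) \<le> r / V x"
    using V_pos[OF assms(1)] by (simp add: pos_le_divide_eq mult.commute)
  then show ?thesis
    using pos_inv_le_iff[of "tail M \<xi> x" "r / V x"] V_pos[OF assms(1)] assms(2)
    by (simp add: tail_nonneg)
qed

lemma tail_bounded_mono:
  assumes "tail_bounded \<xi> r" "0 \<le> r" "r \<le> s"
  shows "tail_bounded \<xi> s"
  unfolding tail_bounded_def
proof (intro allI impI)
  fix x :: real
  assume x: "0 < x"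
  have "W (r / V x) \<le> W (s / V x)"
    using assms V_pos[OF x] by (subst W_le_iff) (auto intro: divide_right_mono)
  with tail_boundedD[OF assms(1) x] show "tail M \<xi> x \<le> W (s / V x)"
    by simp
qed

lemma mem_DVW_iff:
  "\<xi> \<in> DVW M V W \<longleftrightarrow> \<xi> \<in> borel_measurable M \<and> (\<exists>r\<ge>0. tail_bounded \<xi> r)"
proof -
  let ?F = "\<lambda>x. V x * pos_inv W (tail M \<xi> x)"
  have "bdd_above (?F ` {0..}) \<longleftrightarrow> (\<exists>r\<ge>0. tail_bounded \<xi> r)"
  proof
    assume "bdd_above (?F ` {0..})"
    then obtain b where b: "\<And>x. 0 \<le> x \<Longrightarrow> ?F x \<le> b"
      by (auto simp: bdd_above_def)
    have "tail_bounded \<xi> (max 0 b)"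
      unfolding tail_bounded_def
    proof (intro allI impI)
      fix x :: real
      assume "0 < x"
      then show "tail M \<xi> x \<le> W (max 0 b / V x)"
        using b[of x] weighted_le_iff[of x "max 0 b" \<xi>] by (simp add: le_max_iff_disj)
    qed
    then show "\<exists>r\<ge>0. tail_bounded \<xi> r"
      by (intro exI[of _ "max 0 b"]) simp
  next
    assume "\<exists>r\<ge>0. tail_bounded \<xi> r"
    then obtain r where r: "0 \<le> r" "tail_bounded \<xi> r" by blast
    \<comment> \<open>The sign of \<open>V 0\<close> is arbitrary, so the point 0 is bounded separately.\<close>
    have "?F x \<le> max (?F 0) r" if "0 \<le> x" for x
    proof (cases "x = 0")
      case False
      with that have "0 < x" by simp
      then show ?thesis
        using weighted_le_iff[of x r \<xi>] tail_boundedD[OF r(2)] r(1) by auto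
    qed simp
    then show "bdd_above (?F ` {0..})"
      by (intro bdd_aboveI[of _ "max (?F 0) r"]) auto
  qed
  then show ?thesis
    by (simp add: DVW_def)
qed

lemma DVW_measurable: "\<xi> \<in> DVW M V W \<Longrightarrow> \<xi> \<in> borel_measurable M"
  by (simp add: mem_DVW_iff)

text \<open>
  From here on the supremum is replaced by a family of tail estimates, one for each level, which
  can be added, rescaled and passed to the limit separately.
\<close>

lemma VW_norm_le_iff:
  assumes "\<xi> \<in> DVW M V W" "0 \<le> c"
  shows "VW_norm M V W \<xi> \<le> c \<longleftrightarrow> tail_bounded \<xi> (c\<^sup>2)"
proof -
  let ?F = "\<lambda>x. V x * pos_inv W (tail M \<xi> x)"
  have "bdd_above (?F ` {0..})"
    using assms(1) by (simp add: DVW_def)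
  then have "bdd_above (?F ` {0<..})"
    by (rule bdd_above_mono) auto
  then have "(SUP x\<in>{0<..}. ?F x) \<le> c\<^sup>2 \<longleftrightarrow> (\<forall>x\<in>{0<..}. ?F x \<le> c\<^sup>2)"
    by (intro cSUP_le_iff) auto
  moreover have "VW_norm M V W \<xi> \<le> c \<longleftrightarrow> (SUP x\<in>{0<..}. ?F x) \<le> c\<^sup>2"
    unfolding VW_norm_def using assms(2) by (metis real_sqrt_abs real_sqrt_le_iff abs_of_nonneg)
  ultimately show ?thesis
    by (auto simp: tail_bounded_def weighted_le_iff)
qed

lemma VW_norm_nonneg:
  assumes "\<xi> \<in> DVW M V W"
  shows "0 \<le> VW_norm M V W \<xi>"
proof -
  let ?F = "\<lambda>x. V x * pos_inv W (tail M \<xi> x)"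
  have "bdd_above (?F ` {0..})"
    using assms by (simp add: DVW_def)
  then have "bdd_above (?F ` {0<..})"
    by (rule bdd_above_mono) auto
  then have "?F 1 \<le> (SUP x\<in>{0<..}. ?F x)"
    by (intro cSUP_upper) auto
  moreover have "0 \<le> ?F 1"
    using V_pos[of 1] W_pos_inv(2)[OF tail_nonneg] by simp
  ultimately show ?thesis
    by (simp add: VW_norm_def)
qed

text \<open>
  The estimate holds with the norm itself in place of a larger constant, because the condition on
  the constant is a family of non-strict inequalities.
\<close>

lemma tail_bounded_VW_norm: "\<xi> \<in> DVW M V W \<Longrightarrow> tail_bounded \<xi> ((VW_norm M V W \<xi>)\<^sup>2)"
  using VW_norm_le_iff[of \<xi> "VW_norm M V W \<xi>"] VW_norm_nonneg by simp

lemma VW_norm_leI: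
  assumes "\<xi> \<in> borel_measurable M" "0 \<le> c" "tail_bounded \<xi> (c\<^sup>2)"
  shows "\<xi> \<in> DVW M V W" and "VW_norm M V W \<xi> \<le> c"
proof -
  show "\<xi> \<in> DVW M V W"
    using assms zero_le_power2[of c] unfolding mem_DVW_iff by blast
  then show "VW_norm M V W \<xi> \<le> c"
    using assms VW_norm_le_iff by simp
qed

lemma tail_bounded_zero: "tail_bounded (\<lambda>\<omega>. 0) 0"
  by (simp add: tail_bounded_def tail_def W_0)

lemma prenorm_on_DVW: "prenorm_on (DVW M V W) (VW_norm M V W)"
proof -
  have "(\<lambda>\<omega>. 0) \<in> DVW M V W" "VW_norm M V W (\<lambda>\<omega>. 0) \<le> 0"
    using VW_norm_leI[of "\<lambda>\<omega>. 0" 0] tail_bounded_zero by simp_all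
  moreover have "VW_norm M V W (\<lambda>\<omega>. - \<xi> \<omega>) = VW_norm M V W \<xi>" for \<xi>
    by (simp add: VW_norm_def tail_uminus)
  ultimately show ?thesis
    using VW_norm_nonneg by (auto simp: prenorm_on_def intro: order_antisym)
qed

lemma VW_norm_eq_0_iff:
  assumes "\<xi> \<in> DVW M V W"
  shows "VW_norm M V W \<xi> = 0 \<longleftrightarrow> (AE \<omega> in M. \<xi> \<omega> = 0)"
proof -
  note [measurable] = DVW_measurable[OF assms]
  have "VW_norm M V W \<xi> = 0 \<longleftrightarrow> tail_bounded \<xi> 0"
    using VW_norm_le_iff[OF assms, of 0] VW_norm_nonneg[OF assms] by auto
  also have "\<dots> \<longleftrightarrow> (\<forall>x>0. tail M \<xi> x = 0)"
    using tail_nonneg by (auto simp: tail_bounded_def W_0 intro: order_antisym)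
  also have "\<dots> \<longleftrightarrow> (AE \<omega> in M. \<xi> \<omega> = 0)"
  proof
    assume "AE \<omega> in M. \<xi> \<omega> = 0"
    show "\<forall>x>0. tail M \<xi> x = 0"
    proof (intro allI impI)
      fix x :: real
      assume "0 < x"
      with \<open>AE \<omega> in M. \<xi> \<omega> = 0\<close> have "tail M \<xi> x \<le> tail M (\<lambda>\<omega>. 0) x"
        by (intro tail_mono) auto
      with \<open>0 < x\<close> show "tail M \<xi> x = 0"
        using tail_nonneg[of \<xi> x] by (auto simp: tail_def intro: order_antisym)
    qed
  qed (simp add: AE_eq_0_if_tail_eq_0)
  finally show ?thesis .
qed

lemma VW_norm_cmult_le:
  assumes "\<xi> \<in> DVW M V W" "\<bar>c\<bar> \<le> 1"
  shows "VW_norm M V W (\<lambda>\<omega>. c * \<xi> \<omega>) \<le> VW_norm M V W \<xi>"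
proof (rule VW_norm_leI(2))
  note [measurable] = DVW_measurable[OF assms(1)]
  show "(\<lambda>\<omega>. c * \<xi> \<omega>) \<in> borel_measurable M"
    by measurable
  have "tail M (\<lambda>\<omega>. c * \<xi> \<omega>) x \<le> tail M \<xi> x" for x
  proof (rule tail_mono)
    show "AE \<omega> in M. x < \<bar>c * \<xi> \<omega>\<bar> \<longrightarrow> x < \<bar>\<xi> \<omega>\<bar>"
    proof (intro AE_I2 impI)
      fix \<omega>
      assume "x < \<bar>c * \<xi> \<omega>\<bar>"
      also have "\<dots> \<le> \<bar>\<xi> \<omega>\<bar>"
        using assms(2) by (simp add: abs_mult mult_left_le_one_le)
      finally show "x < \<bar>\<xi> \<omega>\<bar>" .
    qed
  qed measurable
  then show "tail_bounded (\<lambda>\<omega>. c * \<xi> \<omega>) ((VW_norm M V W \<xi>)\<^sup>2)"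
    using tail_bounded_VW_norm[OF assms(1)] by (auto simp: tail_bounded_def intro: order_trans)
qed (rule VW_norm_nonneg[OF assms(1)])

text \<open>
  Here \<open>W_superadd\<close> and \<open>V_star\<close> are what convexity of \<^term>\<open>W\<close> and concavity of \<^term>\<open>V\<close> contribute.
  The constants \<open>a\<close> and \<open>b\<close> are taken strictly above the norms, because the proportion \<open>a / (a + b)\<close>
  must lie strictly between 0 and 1.
\<close>

lemma VW_norm_triangle:
  assumes W_superadd: "\<And>s t. 0 \<le> s \<Longrightarrow> 0 \<le> t \<Longrightarrow> W s + W t \<le> W (s + t)"
    and V_star: "\<And>t x. 0 < t \<Longrightarrow> t \<le> 1 \<Longrightarrow> 0 < x \<Longrightarrow> t * V x \<le> V (t * x)"
    and \<xi>: "\<xi> \<in> DVW M V W" and \<eta>: "\<eta> \<in> DVW M V W"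
  shows "VW_norm M V W (\<lambda>\<omega>. \<xi> \<omega> + \<eta> \<omega>) \<le> VW_norm M V W \<xi> + VW_norm M V W \<eta>"
proof (rule field_le_epsilon)
  note [measurable] = DVW_measurable[OF \<xi>] DVW_measurable[OF \<eta>]
  fix e :: real
  assume e: "0 < e"
  define a where "a = VW_norm M V W \<xi> + e / 2"
  define b where "b = VW_norm M V W \<eta> + e / 2"
  have ab: "0 < a" "0 < b"
    using VW_norm_nonneg[OF \<xi>] VW_norm_nonneg[OF \<eta>] e by (auto simp: a_def b_def)
  have bounds: "tail_bounded \<xi> (a\<^sup>2)" "tail_bounded \<eta> (b\<^sup>2)"
    using VW_norm_le_iff[OF \<xi>, of a] VW_norm_le_iff[OF \<eta>, of b] ab e by (auto simp: a_def b_def)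
  have part: "tail M \<zeta> (c / (a + b) * x) \<le> W (c * (a + b) / V x)"
    if \<zeta>: "tail_bounded \<zeta> (c\<^sup>2)" and c: "0 < c" "c \<le> a + b" and x: "0 < x" for \<zeta> c x
  proof -
    let ?t = "c / (a + b)"
    have t: "0 < ?t" "?t \<le> 1"
      using ab c by auto
    have "c\<^sup>2 / V (?t * x) \<le> c\<^sup>2 / (?t * V x)"
      by (intro divide_left_mono V_star t x mult_pos_pos V_pos) simp
    also have "\<dots> = c * (a + b) / V x"
      using ab c by (simp add: power2_eq_square)
    finally have "W (c\<^sup>2 / V (?t * x)) \<le> W (c * (a + b) / V x)"
      using ab c V_pos[OF x] V_pos[of "?t * x"] t x by (subst W_le_iff) auto
    moreover have "tail M \<zeta> (?t * x) \<le> W (c\<^sup>2 / V (?t * x))"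
      using t x by (intro tail_boundedD[OF \<zeta>] mult_pos_pos)
    ultimately show ?thesis by simp
  qed
  have "tail_bounded (\<lambda>\<omega>. \<xi> \<omega> + \<eta> \<omega>) ((a + b)\<^sup>2)"
    unfolding tail_bounded_def
  proof (intro allI impI)
    fix x :: real
    assume x: "0 < x"
    have "x = a / (a + b) * x + b / (a + b) * x"
      using ab by (simp flip: add_divide_distrib distrib_right)
    then have "tail M (\<lambda>\<omega>. \<xi> \<omega> + \<eta> \<omega>) x
        \<le> tail M \<xi> (a / (a + b) * x) + tail M \<eta> (b / (a + b) * x)"
      using tail_add_le[of \<xi> \<eta> "a / (a + b) * x" "b / (a + b) * x"] by simp
    also have "\<dots> \<le> W (a * (a + b) / V x) + W (b * (a + b) / V x)"
      using ab x by (intro add_mono part bounds) auto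
    also have "\<dots> \<le> W (a * (a + b) / V x + b * (a + b) / V x)"
      using ab V_pos[OF x] by (intro W_superadd) auto
    also have "a * (a + b) / V x + b * (a + b) / V x = (a + b)\<^sup>2 / V x"
      by (simp add: power2_eq_square distrib_right add_divide_distrib)
    finally show "tail M (\<lambda>\<omega>. \<xi> \<omega> + \<eta> \<omega>) x \<le> W ((a + b)\<^sup>2 / V x)" .
  qed
  then have "VW_norm M V W (\<lambda>\<omega>. \<xi> \<omega> + \<eta> \<omega>) \<le> a + b"
    using ab by (intro VW_norm_leI(2)) auto
  then show "VW_norm M V W (\<lambda>\<omega>. \<xi> \<omega> + \<eta> \<omega>) \<le> VW_norm M V W \<xi> + VW_norm M V W \<eta> + e"
    by (simp add: a_def b_def)
qed

end

section \<open>Linearity and completeness\<close>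

locale growth_gauge = tail_gauge M V W for M :: "'a measure" and V W +
  fixes Z :: "real \<Rightarrow> real" and C :: real
  assumes V_Z: "0 < a \<Longrightarrow> 0 < x \<Longrightarrow> V (a * x) \<le> Z a * V x"
    and W_inv: "0 < p \<Longrightarrow> 0 < q \<Longrightarrow> pos_inv W (p + q) \<le> C * (pos_inv W p + pos_inv W q)"
begin

lemma V_dilate:
  assumes "0 < a" "0 < x"
  shows "V x \<le> Z a * V (x / a)"
  using V_Z[of a "x / a"] assms by simp

lemma Z_pos:
  assumes "0 < a"
  shows "0 < Z a"
proof -
  have "0 < Z a * V 1"
    using V_Z[OF assms, of 1] V_pos[OF assms] by simp
  then show ?thesis
    using V_pos[of 1] by (simp add: zero_less_mult_iff)
qed

lemma dilate_bound:
  assumes "0 < a" "0 < x" "0 \<le> r"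
  shows "W (r / V (x / a)) \<le> W (Z a * r / V x)"
proof -
  have "V x * r \<le> Z a * V (x / a) * r"
    using V_dilate[OF assms(1,2)] assms(3) by (rule mult_right_mono)
  then have "r / V (x / a) \<le> Z a * r / V x"
    using V_pos[of x] V_pos[of "x / a"] assms by (simp add: field_simps)
  moreover have "0 \<le> r / V (x / a)" "0 \<le> Z a * r / V x"
    using V_pos[of x] V_pos[of "x / a"] Z_pos[of a] assms by (simp_all add: less_imp_le)
  ultimately show ?thesis
    by (simp add: W_le_iff)
qed

lemma tail_bounded_cmult:
  assumes "tail_bounded \<xi> r" "0 \<le> r" "c \<noteq> 0"
  shows "tail_bounded (\<lambda>\<omega>. c * \<xi> \<omega>) (Z \<bar>c\<bar> * r)"
  unfolding tail_bounded_def
proof (intro allI impI)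
  fix x :: real
  assume x: "0 < x"
  have "tail M (\<lambda>\<omega>. c * \<xi> \<omega>) x \<le> W (r / V (x / \<bar>c\<bar>))"
    using assms(3) x by (subst tail_cmult) (auto intro!: tail_boundedD[OF assms(1)])
  also have "\<dots> \<le> W (Z \<bar>c\<bar> * r / V x)"
    using assms x by (intro dilate_bound) auto
  finally show "tail M (\<lambda>\<omega>. c * \<xi> \<omega>) x \<le> W (Z \<bar>c\<bar> * r / V x)" .
qed

text \<open>
  The hypothesis on the inverse of \<^term>\<open>W\<close>, read through \<^term>\<open>W\<close>. It concerns positive arguments
  only; the constant is raised to at least 1 to cover a vanishing \<open>s\<close> or \<open>t\<close> as well.
\<close>

lemma W_add_le:
  assumes "0 \<le> s" "0 \<le> t"
  shows "W s + W t \<le> W (max 1 C * (s + t))"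
proof (cases "s = 0 \<or> t = 0")
  case True
  then have "W s + W t = W (s + t)"
    by (auto simp: W_0)
  also have "\<dots> \<le> W (max 1 C * (s + t))"
    using assms mult_right_mono[of 1 "max 1 C" "s + t"] by (subst W_le_iff) auto
  finally show ?thesis .
next
  case False
  then have pos: "0 < W s" "0 < W t"
    using assms W_le_iff[of s 0] W_le_iff[of t 0] W_0 by auto
  have "pos_inv W (W s + W t) \<le> C * (s + t)"
    using W_inv[OF pos] assms by (simp add: pos_inv_W)
  also have "\<dots> \<le> max 1 C * (s + t)"
    using assms by (intro mult_right_mono) auto
  finally show ?thesis
    using pos assms by (subst (asm) pos_inv_le_iff) auto
qed

lemma tail_bounded_add:
  assumes [measurable]: "\<xi> \<in> borel_measurable M" "\<eta> \<in> borel_measurable M"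
    and \<xi>: "tail_bounded \<xi> r" "0 \<le> r" and \<eta>: "tail_bounded \<eta> s" "0 \<le> s"
  shows "tail_bounded (\<lambda>\<omega>. \<xi> \<omega> + \<eta> \<omega>) (Z 2 * (max 1 C * (r + s)))"
  unfolding tail_bounded_def
proof (intro allI impI)
  fix x :: real
  assume x: "0 < x"
  have V2: "0 < V (x / 2)"
    using x by (intro V_pos) simp
  have "tail M (\<lambda>\<omega>. \<xi> \<omega> + \<eta> \<omega>) x \<le> tail M \<xi> (x / 2) + tail M \<eta> (x / 2)"
    using tail_add_le[of \<xi> \<eta> "x / 2" "x / 2"] by simp
  also have "\<dots> \<le> W (r / V (x / 2)) + W (s / V (x / 2))"
    using x by (intro add_mono tail_boundedD \<xi> \<eta>) auto
  also have "\<dots> \<le> W (max 1 C * (r / V (x / 2) + s / V (x / 2)))"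
    using \<xi> \<eta> V2 by (intro W_add_le) auto
  also have "max 1 C * (r / V (x / 2) + s / V (x / 2)) = max 1 C * (r + s) / V (x / 2)"
    by (simp flip: add_divide_distrib)
  also have "W (max 1 C * (r + s) / V (x / 2)) \<le> W (Z 2 * (max 1 C * (r + s)) / V x)"
    using \<xi> \<eta> x by (intro dilate_bound) auto
  finally show "tail M (\<lambda>\<omega>. \<xi> \<omega> + \<eta> \<omega>) x \<le> W (Z 2 * (max 1 C * (r + s)) / V x)" .
qed

lemma DVW_add:
  assumes "\<xi> \<in> DVW M V W" "\<eta> \<in> DVW M V W"
  shows "(\<lambda>\<omega>. \<xi> \<omega> + \<eta> \<omega>) \<in> DVW M V W"
proof -
  obtain r s where rs: "0 \<le> r" "tail_bounded \<xi> r" "0 \<le> s" "tail_bounded \<eta> s"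
    using assms by (auto simp: mem_DVW_iff)
  have meas: "\<xi> \<in> borel_measurable M" "\<eta> \<in> borel_measurable M"
    using assms by (auto intro: DVW_measurable)
  have "0 \<le> Z 2 * (max 1 C * (r + s))"
    using rs Z_pos[of 2] by simp
  then show ?thesis
    using tail_bounded_add[OF meas rs(2,1,4,3)] meas by (auto simp: mem_DVW_iff)
qed

lemma DVW_cmult:
  assumes "\<xi> \<in> DVW M V W"
  shows "(\<lambda>\<omega>. c * \<xi> \<omega>) \<in> DVW M V W"
proof (cases "c = 0")
  case True
  then show ?thesis
    using VW_norm_leI(1)[of "\<lambda>\<omega>. 0" 0] tail_bounded_zero by simp
next
  case False
  obtain r where r: "0 \<le> r" "tail_bounded \<xi> r"
    using assms by (auto simp: mem_DVW_iff)
  have "0 \<le> Z \<bar>c\<bar> * r"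
    using r Z_pos[of "\<bar>c\<bar>"] False by simp
  then show ?thesis
    using tail_bounded_cmult[OF r(2,1) False] DVW_measurable[OF assms] by (auto simp: mem_DVW_iff)
qed

lemma linear_rv_space_DVW: "linear_rv_space M (DVW M V W)"
  unfolding linear_rv_space_def
  using DVW_add DVW_cmult DVW_measurable VW_norm_leI(1)[of "\<lambda>\<omega>. 0" 0] tail_bounded_zero by auto

lemma DVW_diff:
  assumes "\<xi> \<in> DVW M V W" "\<eta> \<in> DVW M V W"
  shows "(\<lambda>\<omega>. \<xi> \<omega> - \<eta> \<omega>) \<in> DVW M V W"
  using DVW_add[OF assms(1) DVW_cmult[OF assms(2), of "-1"]] by simp

lemma VW_norm_cmult_le_sqrt_Z:
  assumes "\<xi> \<in> DVW M V W" "c \<noteq> 0"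
  shows "VW_norm M V W (\<lambda>\<omega>. c * \<xi> \<omega>) \<le> sqrt (Z \<bar>c\<bar>) * VW_norm M V W \<xi>"
proof (rule VW_norm_leI(2))
  show "(\<lambda>\<omega>. c * \<xi> \<omega>) \<in> borel_measurable M"
    using DVW_measurable[OF assms(1)] by simp
  have Z: "0 \<le> Z \<bar>c\<bar>"
    using Z_pos[of "\<bar>c\<bar>"] assms(2) by simp
  then show "0 \<le> sqrt (Z \<bar>c\<bar>) * VW_norm M V W \<xi>"
    using VW_norm_nonneg[OF assms(1)] by simp
  show "tail_bounded (\<lambda>\<omega>. c * \<xi> \<omega>) ((sqrt (Z \<bar>c\<bar>) * VW_norm M V W \<xi>)\<^sup>2)"
    using tail_bounded_cmult[OF tail_bounded_VW_norm[OF assms(1)] _ assms(2)] Z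
    by (simp add: power_mult_distrib)
qed

text \<open>
  At the fixed level \<open>e\<close> the estimate \<open>P(\<bar>X m - X n\<bar> > e) \<le> W (c\<^sup>2 / V e)\<close> is at most \<open>e\<close> as soon as
  \<open>c\<^sup>2\<close> is at most \<open>V e * pos_inv W e\<close>.
\<close>

lemma Cauchy_wrt_VW_norm_imp_Cauchy_in_probability:
  assumes X: "\<And>n. X n \<in> DVW M V W" and Cauchy: "Cauchy_wrt (VW_norm M V W) X" and e: "0 < e"
  shows "\<exists>N. \<forall>m\<ge>N. \<forall>n\<ge>N. tail M (\<lambda>\<omega>. X m \<omega> - X n \<omega>) e \<le> e"
proof -
  define c where "c = sqrt (V e * pos_inv W e)"
  have "0 < pos_inv W e"
    using W_pos_inv[of e] W_0 e by (metis less_eq_real_def)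
  then have c: "0 < c" "c\<^sup>2 / V e = pos_inv W e"
    using V_pos[OF e] by (auto simp: c_def)
  obtain N where N: "\<And>m n. m \<ge> N \<Longrightarrow> n \<ge> N \<Longrightarrow> VW_norm M V W (\<lambda>\<omega>. X m \<omega> - X n \<omega>) < c"
    using order_tendstoD(2)[OF Cauchy[unfolded Cauchy_wrt_def] c(1)]
    by (auto simp: eventually_prod_sequentially)
  have "tail M (\<lambda>\<omega>. X m \<omega> - X n \<omega>) e \<le> e" if "m \<ge> N" "n \<ge> N" for m n
  proof -
    have "tail_bounded (\<lambda>\<omega>. X m \<omega> - X n \<omega>) (c\<^sup>2)"
      using N[OF that] c VW_norm_le_iff[OF DVW_diff[OF X X], of c m n] by simp
    then have "tail M (\<lambda>\<omega>. X m \<omega> - X n \<omega>) e \<le> W (c\<^sup>2 / V e)"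
      using e by (rule tail_boundedD)
    also have "\<dots> = e"
      using c W_pos_inv[of e] e by simp
    finally show ?thesis .
  qed
  then show ?thesis by blast
qed

text \<open>
  The limit \<open>\<xi>\<close> comes from convergence in probability only, but every tail estimate for
  \<open>X n - X m\<close> with \<open>m\<close> large is inherited by \<open>X n - \<xi>\<close>. This also puts \<open>\<xi>\<close> into the space, as
  a difference of two of its members.
\<close>

lemma complete_wrt_DVW: "complete_wrt (DVW M V W) (VW_norm M V W)"
  unfolding complete_wrt_def
proof (intro allI impI, elim conjE)
  fix X :: "nat \<Rightarrow> 'a \<Rightarrow> real"
  assume X: "\<forall>n. X n \<in> DVW M V W" and Cauchy: "Cauchy_wrt (VW_norm M V W) X"
  have X_meas [measurable]: "X n \<in> borel_measurable M" for n
    using X DVW_measurable by blast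
  obtain r \<xi> where r: "strict_mono r" and \<xi> [measurable]: "\<xi> \<in> borel_measurable M"
    and lim: "AE \<omega> in M. (\<lambda>k. X (r k) \<omega>) \<longlonglongrightarrow> \<xi> \<omega>"
    using Cauchy_in_probability_AE_convergent_subseq[OF X_meas
        Cauchy_wrt_VW_norm_imp_Cauchy_in_probability[OF spec[OF X] Cauchy]] by blast
  have bound: "\<exists>N. \<forall>n\<ge>N. tail_bounded (\<lambda>\<omega>. X n \<omega> - \<xi> \<omega>) (e\<^sup>2)" if e: "0 < e" for e
  proof -
    obtain N where N: "\<And>m n. m \<ge> N \<Longrightarrow> n \<ge> N \<Longrightarrow> VW_norm M V W (\<lambda>\<omega>. X m \<omega> - X n \<omega>) < e"
      using order_tendstoD(2)[OF Cauchy[unfolded Cauchy_wrt_def] e]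
      by (auto simp: eventually_prod_sequentially)
    have "tail_bounded (\<lambda>\<omega>. X n \<omega> - \<xi> \<omega>) (e\<^sup>2)" if n: "n \<ge> N" for n
      unfolding tail_bounded_def
    proof (intro allI impI)
      fix x :: real
      assume x: "0 < x"
      show "tail M (\<lambda>\<omega>. X n \<omega> - \<xi> \<omega>) x \<le> W (e\<^sup>2 / V x)"
      proof (rule tail_AE_limit_le[where Y = "\<lambda>k \<omega>. X n \<omega> - X (r k) \<omega>"])
        show "(\<lambda>\<omega>. X n \<omega> - X (r k) \<omega>) \<in> borel_measurable M" for k
          by measurable
        show "AE \<omega> in M. (\<lambda>k. X n \<omega> - X (r k) \<omega>) \<longlonglongrightarrow> X n \<omega> - \<xi> \<omega>"
          using lim by eventually_elim (intro tendsto_intros)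
        have "tail M (\<lambda>\<omega>. X n \<omega> - X (r k) \<omega>) x \<le> W (e\<^sup>2 / V x)" if "k \<ge> N" for k
        proof -
          have "r k \<ge> N"
            using seq_suble[OF r, of k] that by simp
          then have "tail_bounded (\<lambda>\<omega>. X n \<omega> - X (r k) \<omega>) (e\<^sup>2)"
            using N[OF n, of "r k"] e X VW_norm_le_iff[OF DVW_diff, of "X n" "X (r k)" e] by simp
          then show ?thesis
            using x by (rule tail_boundedD)
        qed
        then show "\<forall>\<^sub>F k in sequentially. tail M (\<lambda>\<omega>. X n \<omega> - X (r k) \<omega>) x \<le> W (e\<^sup>2 / V x)"
          by (auto simp: eventually_sequentially)
      qed
    qed
    then show ?thesis by blast
  qed
  have "\<xi> \<in> DVW M V W"
  proof -
    obtain N where "tail_bounded (\<lambda>\<omega>. X N \<omega> - \<xi> \<omega>) (1\<^sup>2)"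
      using bound[of 1] by force
    then have "(\<lambda>\<omega>. X N \<omega> - \<xi> \<omega>) \<in> DVW M V W"
      by (intro VW_norm_leI(1)[of _ 1]) auto
    then show ?thesis
      using DVW_diff[OF spec[OF X, of N], of "\<lambda>\<omega>. X N \<omega> - \<xi> \<omega>"] by simp
  qed
  moreover have "converges_wrt (VW_norm M V W) X \<xi>"
    unfolding converges_wrt_def
  proof (rule LIMSEQ_I)
    fix e :: real
    assume e: "0 < e"
    then obtain N where N: "\<And>n. n \<ge> N \<Longrightarrow> tail_bounded (\<lambda>\<omega>. X n \<omega> - \<xi> \<omega>) ((e / 2)\<^sup>2)"
      using bound[of "e / 2"] by auto
    have "norm (VW_norm M V W (\<lambda>\<omega>. X n \<omega> - \<xi> \<omega>) - 0) < e" if "n \<ge> N" for n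
      using VW_norm_leI(2)[OF _ _ N[OF that]] e
        VW_norm_nonneg[OF DVW_diff[OF spec[OF X, of n] \<open>\<xi> \<in> DVW M V W\<close>]] by simp
    then show "\<exists>N. \<forall>n\<ge>N. norm (VW_norm M V W (\<lambda>\<omega>. X n \<omega> - \<xi> \<omega>) - 0) < e"
      by blast
  qed
  ultimately show "\<exists>\<xi>\<in>DVW M V W. converges_wrt (VW_norm M V W) X \<xi>"
    by blast
qed

end

section \<open>Convexity\<close>

lemma C_function_scale_le:
  assumes "C_function f" "0 \<le> t" "t \<le> 1"
  shows "f (t * x) \<le> t * f x"
  using assms convex_onD[of UNIV f t 0 x] by (simp add: C_function_def)

lemma C_function_superadd:
  assumes f: "C_function f" and "0 \<le> s" "0 \<le> t"
  shows "f s + f t \<le> f (s + t)"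
proof (cases "s + t = 0")
  case True
  with assms have "s = 0" "t = 0" by auto
  with f show ?thesis by (simp add: C_function_def)
next
  case False
  have "f s \<le> s / (s + t) * f (s + t)" "f t \<le> t / (s + t) * f (s + t)"
    using C_function_scale_le[OF f, of "s / (s + t)" "s + t"]
      C_function_scale_le[OF f, of "t / (s + t)" "s + t"] assms False by simp_all
  then have "f s + f t \<le> (s / (s + t) + t / (s + t)) * f (s + t)"
    by (simp only: distrib_right)
  also have "\<dots> = f (s + t)"
    using False by (simp add: add_divide_distrib[symmetric])
  finally show ?thesis .
qed

lemma C_function_pos:
  assumes f: "C_function f" and x: "0 < x"
  shows "0 < f x"
proof -
  have "f (x / 2) < f x"
    using f x by (auto simp: C_function_def intro: strict_mono_onD)
  \<comment> \<open>Evenness and convexity put the minimum at 0, the midpoint of \<open>- x / 2\<close> and \<open>x / 2\<close>.\<close>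
  moreover have "0 \<le> f (x / 2)"
    using f convex_onD[of UNIV f "1/2" "- (x / 2)" "x / 2"]
    by (simp add: C_function_def)
  ultimately show ?thesis by simp
qed

lemma C_function_strict_mono:
  assumes f: "C_function f"
  shows "strict_mono_on {0..} f"
proof (rule strict_mono_onI)
  fix s t :: real
  assume "s \<in> {0..}" "t \<in> {0..}" "s < t"
  then show "f s < f t"
    using f C_function_pos[OF f, of t] strict_mono_onD[of "{0<..}" f s t]
    by (cases "s = 0") (auto simp: C_function_def)
qed

text \<open>Convexity forces at least linear growth, \<open>x * f 1 \<le> f x\<close> for \<open>x \<ge> 1\<close>.\<close>

lemma C_function_onto:
  assumes f: "C_function f" and y: "0 \<le> y"
  shows "y \<in> f ` {0..}"
proof -
  define b where "b = max 1 (y / f 1)"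
  have f1: "0 < f 1"
    using C_function_pos[OF f, of 1] by simp
  have b: "1 \<le> b"
    by (simp add: b_def)
  have "f 1 \<le> 1 / b * f b"
    using C_function_scale_le[OF f, of "1 / b" b] b by simp
  then have "b * f 1 \<le> f b"
    using b by (simp add: field_simps)
  moreover have "y \<le> b * f 1"
    using f1 by (simp add: b_def pos_divide_le_eq[symmetric])
  ultimately have "y \<le> f b" by simp
  moreover have "f 0 \<le> y" "0 \<le> b" "continuous_on {0..b} f"
    using f y by (auto simp: C_function_def b_def intro: continuous_on_subset)
  ultimately obtain x where "0 \<le> x" "f x = y"
    using IVT'[of f 0 y b] by auto
  then show ?thesis by auto
qed

text \<open>
  The form in which concavity of the inverse is used; it is the scaling inequality of \<open>f\<close>, read
  through the monotone map \<open>f\<close> itself.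
\<close>

lemma pos_inv_C_function_star:
  assumes f: "C_function f" and t: "0 \<le> t" "t \<le> 1" and x: "0 \<le> x"
  shows "t * pos_inv f x \<le> pos_inv f (t * x)"
proof -
  have inv: "f (pos_inv f y) = y" "0 \<le> pos_inv f y" if "0 \<le> y" for y
    using C_function_onto[OF f that] f_inv_into_f[of y f "{0..}"] inv_into_into[of y f "{0..}"]
    by (auto simp: pos_inv_def)
  have "f (t * pos_inv f x) \<le> t * x"
    using C_function_scale_le[OF f t, of "pos_inv f x"] inv[OF x] by simp
  also have "t * x = f (pos_inv f (t * x))"
    using t x by (simp add: inv)
  finally show ?thesis
    using strict_mono_on_less_eq[OF C_function_strict_mono[OF f],
        of "t * pos_inv f x" "pos_inv f (t * x)"] t x inv(2) by simp
qed

lemma (in growth_gauge) quasinorm_on_DVW: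
  assumes "cond_B1 V W"
  shows "quasinorm_on M (DVW M V W) (VW_norm M V W)"
proof -
  obtain U where U: "C_function U" "\<And>x. V x = pos_inv U \<bar>x\<bar>" and W: "C_function W"
    using assms by (auto simp: cond_B1_def)
  have "t * V x \<le> V (t * x)" if "0 < t" "t \<le> 1" "0 < x" for t x
    using pos_inv_C_function_star[OF U(1), of t x] that by (simp add: U(2) abs_mult)
  then show ?thesis
    unfolding quasinorm_on_def
    using VW_norm_nonneg VW_norm_eq_0_iff VW_norm_cmult_le
      VW_norm_triangle[OF C_function_superadd[OF W]] by blast
qed

section \<open>The space of random variables with dominated tails\<close>

theorem theorem6p1:
  fixes M :: "'a measure" and V W Z :: "real \<Rightarrow> real"
  assumes "prob_space M"
    and V_even: "\<And>x. V (- x) = V x"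
    and V_cont: "continuous_on {0<..} V"
    and V_mono: "strict_mono_on {0<..} V"
    and V_pos: "\<And>x. x \<noteq> 0 \<Longrightarrow> 0 < V x"
    and W_even: "\<And>x. W (- x) = W x"
    and W_cont: "continuous_on {0<..} W"
    and W_mono: "strict_mono_on {0<..} W"
    and W_pos: "\<And>x. x \<noteq> 0 \<Longrightarrow> 0 < W x"
    and W_onto: "W ` {0<..} = {0<..}"
    and W_inv: "\<exists>C>0. \<forall>x>0. \<forall>y>0. pos_inv W (x + y) \<le> C * (pos_inv W x + pos_inv W y)"
    and Z_cont: "continuous_on {0<..} Z"
    and Z_pos: "\<And>x. 0 < x \<Longrightarrow> 0 < Z x"
    and V_Z: "\<And>a x. 0 < a \<Longrightarrow> 0 < x \<Longrightarrow> V (a * x) \<le> Z a * V x"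
    and W_0: "W 0 = 0"
  shows "(linear_rv_space M (DVW M V W) \<and> prenorm_on (DVW M V W) (VW_norm M V W)) \<and>
    (\<forall>X. (\<forall>n. X n \<in> DVW M V W) \<and> Cauchy_wrt (VW_norm M V W) X \<and>
         bdd_above (range (\<lambda>n. VW_norm M V W (X n))) \<longrightarrow>
         (\<exists>\<xi>\<in>DVW M V W. converges_wrt (VW_norm M V W) X \<xi>)) \<and>
    (\<forall>\<xi>\<in>DVW M V W. \<forall>c. 0 < \<bar>c\<bar> \<and> \<bar>c\<bar> \<le> 1 \<longrightarrow>
         VW_norm M V W (\<lambda>\<omega>. c * \<xi> \<omega>) \<le> sqrt (Z \<bar>c\<bar>) * VW_norm M V W \<xi>) \<and>
    (cond_B1 V W \<longrightarrow>
         quasinorm_on M (DVW M V W) (VW_norm M V W) \<and>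
         complete_wrt (DVW M V W) (VW_norm M V W)) \<and>
    (\<forall>\<xi>\<in>DVW M V W. \<forall>x>0.
         measure M {\<omega> \<in> space M. \<bar>\<xi> \<omega>\<bar> > x} \<le> W ((VW_norm M V W \<xi>)\<^sup>2 / V x))"
proof -
  interpret prob_space M by fact
  obtain C where C:
    "\<And>x y. 0 < x \<Longrightarrow> 0 < y \<Longrightarrow> pos_inv W (x + y) \<le> C * (pos_inv W x + pos_inv W y)"
    using W_inv by blast
  interpret growth_gauge M V W Z C
  proof
    show "strict_mono_on {0..} W"
    proof (rule strict_mono_onI)
      fix s t :: real
      assume "s \<in> {0..}" "t \<in> {0..}" "s < t"
      then show "W s < W t"
        using W_0 W_pos[of t] strict_mono_onD[OF W_mono, of s t] by (cases "s = 0") auto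
    qed
    have "{0..} = insert (0::real) {0<..}" by auto
    then show "W ` {0..} = {0..}"
      using W_onto W_0 by simp
  qed (use V_pos V_Z C in auto)
  show ?thesis
    using linear_rv_space_DVW prenorm_on_DVW complete_wrt_DVW quasinorm_on_DVW
      VW_norm_cmult_le_sqrt_Z tail_boundedD[OF tail_bounded_VW_norm]
    by (auto simp: complete_wrt_def tail_def)
qed

end
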